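(* Let $r_1,r_2,\rho_1,\rho_2$ be real numbers and let $L$ be the Dunkl shift operator $$Lf(x)=\frac{(x-\rho_1)(x-\rho_2)}{2x}\,(f(x)-f(-x))+\frac{(x-r_1+1/2)(x-r_2+1/2)}{2x+1}\,(f(-x-1)-f(x)).$$ Define polynomials $\phi_n$ by $$\phi_{2n}(x)=(x-r_1+\tfrac12)_n\,(-x-r_1+\tfrac12)_n,\qquad \phi_{2n+1}(x)=(x-r_1+\tfrac12)_{n+1}\,(-x-r_1+\tfrac12)_n,\qquad n\ge0.$$ Then $\phi_n(x)=(-1)^{n(n-1)/2}x^n+O(x^{n-1})$ and, for every $n\ge0$, $$L\phi_n=\lambda_n\phi_n+\nu_n\phi_{n-1}$$ (with $\phi_{-1}=0$), where $$\lambda_n=\begin{cases}\frac n2,& n\text{ even},\\ r_1+r_2-\rho_1-\rho_2-\frac{n+1}{2},& n\text{ odd},\end{cases}\qquad \nu_n=\begin{cases}\frac n2\left(r_1+r_2-\frac n2\right),& n\text{ even},\\ \left(\rho_1-r_1+\frac n2\right)\left(\rho_2-r_1+\frac n2\right),& n\text{ odd}.\end{cases}$$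
   Context: $(x)_n=x(x+1)\cdots(x+n-1)$ is the shifted factorial (Pochhammer symbol), $(x)_0=1$. The operator $L$ maps polynomials to polynomials (the apparent poles at $x=0,-1/2$ cancel). *)

theory Defs
  imports "HOL-Computational_Algebra.Polynomial" "HOL-Library.Landau_Symbols"
begin

text \<open>
  Both polynomial divisions are exact (lemma \<open>dunkl_shift_dvd\<close>), so the operator agrees with its
  rational expression away from the apparent poles (lemma \<open>poly_dunkl_shift\<close>); this determines
  the resulting polynomial.
\<close>

definition dunkl_shift :: "real \<Rightarrow> real \<Rightarrow> real \<Rightarrow> real \<Rightarrow> real poly \<Rightarrow> real poly" where
  "dunkl_shift r1 r2 \<rho>1 \<rho>2 f =
     [:-\<rho>1, 1:] * [:-\<rho>2, 1:] * ((f - pcompose f [:0, -1:]) div [:0, 2:]) +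
     [:1/2 - r1, 1:] * [:1/2 - r2, 1:] * ((pcompose f [:-1, -1:] - f) div [:1, 2:])"

lemma dunkl_shift_dvd:
  fixes f :: "real poly"
  shows "[:0, 2:] dvd f - pcompose f [:0, -1:]"
    and "[:1, 2:] dvd pcompose f [:-1, -1:] - f"
proof -
  have "[:-0, 1:] dvd f - pcompose f [:0, -1:]"
    by (subst poly_eq_0_iff_dvd [symmetric]) (simp add: poly_pcompose)
  then have "smult 2 [:-0, 1:] dvd f - pcompose f [:0, -1:]"
    by (rule smult_dvd) simp
  then show "[:0, 2:] dvd f - pcompose f [:0, -1:]" by simp
  have "[:-(-1/2), 1:] dvd pcompose f [:-1, -1:] - f"
    by (subst poly_eq_0_iff_dvd [symmetric]) (simp add: poly_pcompose)
  then have "smult 2 [:-(-1/2), 1:] dvd pcompose f [:-1, -1:] - f"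
    by (rule smult_dvd) simp
  then show "[:1, 2:] dvd pcompose f [:-1, -1:] - f" by simp
qed

lemma poly_dunkl_shift:
  fixes x :: real
  assumes "x \<noteq> 0" "x \<noteq> -1/2"
  shows "poly (dunkl_shift r1 r2 \<rho>1 \<rho>2 f) x =
    (x - \<rho>1) * (x - \<rho>2) / (2 * x) * (poly f x - poly f (-x)) +
    (x - r1 + 1/2) * (x - r2 + 1/2) / (2 * x + 1) * (poly f (-x - 1) - poly f x)"
proof -
  define A where "A = (f - pcompose f [:0, -1:]) div [:0, 2:]"
  define B where "B = (pcompose f [:-1, -1:] - f) div [:1, 2:]"
  have "A * [:0, 2:] = f - pcompose f [:0, -1:]"
    unfolding A_def by (rule dvd_div_mult_self) (rule dunkl_shift_dvd)
  from arg_cong [OF this, of "\<lambda>p. poly p x"]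
  have A: "poly A x * (2 * x) = poly f x - poly f (-x)"
    by (simp add: poly_pcompose algebra_simps)
  have "B * [:1, 2:] = pcompose f [:-1, -1:] - f"
    unfolding B_def by (rule dvd_div_mult_self) (rule dunkl_shift_dvd)
  from arg_cong [OF this, of "\<lambda>p. poly p x"]
  have B: "poly B x * (2 * x + 1) = poly f (-x - 1) - poly f x"
    by (simp add: poly_pcompose algebra_simps minus_diff_commute)
  have nz: "2 * x \<noteq> 0" "2 * x + 1 \<noteq> 0" using assms by auto
  have "poly (dunkl_shift r1 r2 \<rho>1 \<rho>2 f) x =
      (x - \<rho>1) * (x - \<rho>2) * poly A x + (x - r1 + 1/2) * (x - r2 + 1/2) * poly B x"
    unfolding dunkl_shift_def A_def [symmetric] B_def [symmetric]
    by (simp add: algebra_simps)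
  also have "\<dots> = (x - \<rho>1) * (x - \<rho>2) / (2 * x) * (poly A x * (2 * x)) +
      (x - r1 + 1/2) * (x - r2 + 1/2) / (2 * x + 1) * (poly B x * (2 * x + 1))"
    using nz by simp
  finally show ?thesis unfolding A B .
qed

definition phi :: "real \<Rightarrow> nat \<Rightarrow> real poly" where
  "phi r1 m = (let n = m div 2 in
     if even m then pochhammer [:1/2 - r1, 1:] n * pochhammer [:1/2 - r1, -1:] n
     else pochhammer [:1/2 - r1, 1:] (n + 1) * pochhammer [:1/2 - r1, -1:] n)"

lemma poly_pochhammer: "poly (pochhammer p n) x = pochhammer (poly p x) n"
  for p :: "'a::comm_ring_1 poly"
  by (simp add: pochhammer_prod poly_prod)

lemma poly_phi:
  "poly (phi r1 (2 * n)) x = pochhammer (x - r1 + 1/2) n * pochhammer (-x - r1 + 1/2) n"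
  "poly (phi r1 (2 * n + 1)) x = pochhammer (x - r1 + 1/2) (n + 1) * pochhammer (-x - r1 + 1/2) n"
proof -
  have *: "poly [:1/2 - r1, 1:] x = x - r1 + 1/2" "poly [:1/2 - r1, -1:] x = -x - r1 + 1/2"
    by simp_all
  show
    "poly (phi r1 (2 * n)) x = pochhammer (x - r1 + 1/2) n * pochhammer (-x - r1 + 1/2) n"
    "poly (phi r1 (2 * n + 1)) x = pochhammer (x - r1 + 1/2) (n + 1) * pochhammer (-x - r1 + 1/2) n"
    unfolding phi_def Let_def * [symmetric] poly_pochhammer [symmetric] poly_mult [symmetric]
    by simp_all
qed

definition eigval :: "real \<Rightarrow> real \<Rightarrow> real \<Rightarrow> real \<Rightarrow> nat \<Rightarrow> real" where
  "eigval r1 r2 \<rho>1 \<rho>2 n =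
     (if even n then real n / 2 else r1 + r2 - \<rho>1 - \<rho>2 - (real n + 1) / 2)"

definition lowcoeff :: "real \<Rightarrow> real \<Rightarrow> real \<Rightarrow> real \<Rightarrow> nat \<Rightarrow> real" where
  "lowcoeff r1 r2 \<rho>1 \<rho>2 n =
     (if even n then real n / 2 * (r1 + r2 - real n / 2)
      else (\<rho>1 - r1 + real n / 2) * (\<rho>2 - r1 + real n / 2))"

end

theory Submission
  imports Defs
begin

text \<open>
  Put \<open>a = 1/2 - r1\<close>. The basis is adapted to the two reflections in \<open>L\<close>: going from one
  \<open>\<phi>\<close> to the next appends one linear factor, alternately of the form \<open>x + a + n\<close> and
  \<open>-x + a + n\<close>. Hence \<open>\<phi>\<^bsub>2n\<^esub>\<close> is invariant under \<open>x \<mapsto> -x\<close>, and \<open>\<phi>\<^bsub>2n+1\<^esub>(x) = (x + a + n) \<phi>\<^bsub>2n\<^esub>(x)\<close>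
  has odd part \<open>x \<phi>\<^bsub>2n\<^esub>(x)\<close>; likewise, under \<open>x \<mapsto> -x - 1\<close> all but at most two linear factors of
  \<open>\<phi>\<^sub>m\<close> are permuted among themselves. Each difference quotient in \<open>L \<phi>\<^sub>m\<close> is therefore
  \<open>\<phi>\<^sub>m\<close> or \<open>\<phi>\<^bsub>m-1\<^esub>\<close> up to a constant and, in the second quotient, a missing factor \<open>x + a\<close>,
  which is supplied by the factor \<open>x - r1 + 1/2\<close> in the coefficient of \<open>L\<close>. What remains is \<open>\<phi>\<^bsub>m-1\<^esub>\<close> times a polynomial of degree at most two, and the
  values of \<open>\<lambda>\<^sub>m\<close> and \<open>\<nu>\<^sub>m\<close> come from expanding it in the one linear factor by which
  \<open>\<phi>\<^sub>m\<close> exceeds \<open>\<phi>\<^bsub>m-1\<^esub>\<close>. These computations (lemmas \<open>dunkl_shift_phi_even\<close> and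
  \<open>dunkl_shift_phi_odd\<close>) are made at points away from the apparent poles, where \<open>L\<close> is given by its
  rational expression; infinitely many such points determine a polynomial.

  The asymptotic statement is a statement about degree and leading coefficient: a product of \<open>n\<close>
  factors of slope \<open>s\<close> has leading term \<open>s ^ n * x ^ n\<close>, and the \<open>m div 2\<close> factors of slope
  \<open>-1\<close> in \<open>\<phi>\<^sub>m\<close> give the sign.
\<close>

section \<open>Leading term\<close>

lemma pochhammer_linear_poly_leading:
  fixes a s :: "'a :: field_char_0"
  assumes "s \<noteq> 0"
  shows "degree (pochhammer [:a, s:] n) = n \<and> lead_coeff (pochhammer [:a, s:] n) = s ^ n"
proof (induction n)
  case 0
  show ?case by simp
next
  case (Suc n)
  have lin: "[:a, s:] + of_nat n = [:a + of_nat n, s:]"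
    by (simp add: of_nat_poly)
  have "pochhammer [:a, s:] n \<noteq> 0"
    using Suc.IH assms by (metis leading_coeff_0_iff power_not_zero)
  moreover have fac: "[:a + of_nat n, s:] \<noteq> 0" "degree [:a + of_nat n, s:] = 1"
      "lead_coeff [:a + of_nat n, s:] = s"
    using assms by auto
  ultimately have deg: "degree (pochhammer [:a, s:] (Suc n)) = Suc n"
    unfolding pochhammer_Suc lin using Suc.IH by (subst degree_mult_eq) auto
  have "lead_coeff (pochhammer [:a, s:] (Suc n)) = s ^ Suc n"
    unfolding pochhammer_Suc lin lead_coeff_mult fac(3) conjunct2 [OF Suc.IH]
    by (rule power_Suc2 [symmetric])
  with deg show ?case by blast
qed

lemma neg_one_power_half_product:
  "(-1 :: 'a :: ring_1) ^ (m * (m - 1) div 2) = (-1) ^ (m div 2)"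
proof (cases "even m")
  case True
  then obtain n where n: "m = 2 * n" by blast
  have "m * (m - 1) div 2 = n * (2 * n - 1)" unfolding n by simp
  moreover have "even (n * (2 * n - 1)) \<longleftrightarrow> even n" by (cases n) auto
  ultimately show ?thesis by (simp add: n minus_one_power_iff)
next
  case False
  then obtain n where n: "m = 2 * n + 1" by (blast elim: oddE)
  have "m * (m - 1) div 2 = n * (2 * n + 1)" unfolding n by simp
  then show ?thesis by (simp add: n minus_one_power_iff)
qed

lemma phi_leading:
  "degree (phi r m) = m" "lead_coeff (phi r m) = (-1) ^ (m * (m - 1) div 2)"
proof -
  define P where "P = pochhammer [:1/2 - r, 1:] (m - m div 2)"
  define Q where "Q = pochhammer [:1/2 - r, -1:] (m div 2)"
  have "m - m div 2 = (if even m then m div 2 else m div 2 + 1)"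
    by presburger
  then have phi: "phi r m = P * Q"
    by (simp add: phi_def P_def Q_def Let_def)
  have P: "degree P = m - m div 2" "lead_coeff P = 1"
    using pochhammer_linear_poly_leading [OF one_neq_zero, of "1/2 - r" "m - m div 2"]
    unfolding P_def power_one by blast+
  have Q: "degree Q = m div 2" "lead_coeff Q = (-1) ^ (m div 2)"
    using pochhammer_linear_poly_leading [of "-1" "1/2 - r" "m div 2"]
    unfolding Q_def by auto
  have "P \<noteq> 0" "Q \<noteq> 0" using P(2) Q(2) by auto
  then show "degree (phi r m) = m"
    unfolding phi by (simp add: degree_mult_eq P Q)
  show "lead_coeff (phi r m) = (-1) ^ (m * (m - 1) div 2)"
    unfolding phi lead_coeff_mult by (simp only: P(2) Q(2) neg_one_power_half_product mult_1_left)
qed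

text \<open>
  The integer exponent matters only for a constant polynomial, where the difference vanishes
  identically; otherwise each remaining monomial is dominated by \<open>x ^ (degree p - 1)\<close>.
\<close>

lemma poly_minus_leading_term_bigo:
  fixes p :: "real poly"
  shows "(\<lambda>x. poly p x - lead_coeff p * x ^ degree p)
           \<in> O[at_infinity](\<lambda>x. x powi (int (degree p) - 1))"
proof (cases "degree p")
  case 0
  then have "poly p x - lead_coeff p * x ^ degree p = 0" for x
    by (simp add: poly_altdef)
  then show ?thesis by simp
next
  case (Suc d)
  have "(\<lambda>x. \<Sum>i\<le>d. coeff p i * x ^ i) \<in> O[at_infinity](\<lambda>x. x ^ d)"
  proof (rule big_sum_in_bigo)
    fix i assume "i \<in> {..d}"
    have "eventually (\<lambda>x::real. norm (x ^ i) \<le> 1 * norm (x ^ d)) at_infinity"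
      unfolding eventually_at_infinity
    proof (intro exI [of _ 1] allI impI)
      fix x :: real
      assume "1 \<le> norm x"
      then show "norm (x ^ i) \<le> 1 * norm (x ^ d)"
        using \<open>i \<in> {..d}\<close> by (simp add: power_abs power_increasing)
    qed
    then have "(\<lambda>x::real. x ^ i) \<in> O[at_infinity](\<lambda>x. x ^ d)"
      by (rule bigoI)
    then show "(\<lambda>x. coeff p i * x ^ i) \<in> O[at_infinity](\<lambda>x. x ^ d)"
      by (cases "coeff p i = 0") simp_all
  qed
  then show ?thesis
    by (simp add: Suc poly_altdef)
qed

section \<open>Action of the shift operator\<close>

lemma poly_eqI_cofinite:
  fixes p q :: "'a :: {idom, ring_char_0} poly"
  assumes "finite A" and "\<And>x. x \<notin> A \<Longrightarrow> poly p x = poly q x"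
  shows "p = q"
proof (rule ccontr)
  assume "p \<noteq> q"
  then have "finite {x. poly (p - q) x = 0}" by (intro poly_roots_finite) simp
  moreover have "- A \<subseteq> {x. poly (p - q) x = 0}" using assms(2) by auto
  ultimately show False
    using assms(1) infinite_UNIV_char_0 [where 'a = 'a]
    by (metis finite_subset finite_Un Compl_partition)
qed

text \<open>
  Evenness of \<open>\<phi>\<^bsub>2n+2\<^esub>\<close> removes the first difference. In the second one the common factor is
  \<open>(x + a + 1)\<^sub>n (-x + a)\<^sub>n\<close>, and the cofactors \<open>(x + a + n + 1)(-x - 1 + a)\<close> and
  \<open>(x + a)(-x + a + n)\<close> differ by \<open>-(n + 1)(2x + 1)\<close>, which cancels the pole.
\<close>

lemma dunkl_shift_phi_even:
  "dunkl_shift r1 r2 \<rho>1 \<rho>2 (phi r1 (2 * n + 2)) =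
     smult (real n + 1) (phi r1 (2 * n + 2)) +
     smult ((real n + 1) * (r1 + r2 - (real n + 1))) (phi r1 (2 * n + 1))"
proof (rule poly_eqI_cofinite [of "{0, -1/2}"])
  fix x :: real
  assume "x \<notin> {0, -1/2}"
  then have x: "x \<noteq> 0" "x \<noteq> -1/2" and nz: "2 * x + 1 \<noteq> 0" by auto
  define a where "a = 1/2 - r1"
  define G where "G = pochhammer (x + a + 1) n * pochhammer (-x + a) n"
  have even: "poly (phi r1 (2 * n + 2)) y =
      pochhammer (y + a) (Suc n) * pochhammer (-y + a) (Suc n)" for y
    using poly_phi(1) [of r1 "Suc n" y] by (simp add: a_def algebra_simps)
  have odd: "poly (phi r1 (2 * n + 1)) x = (x + a) * G"
    using poly_phi(2) [of r1 n x]
    by (simp add: a_def G_def pochhammer_rec algebra_simps)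
  have same: "poly (phi r1 (2 * n + 2)) x = (x + a) * (-x + a + real n) * G"
    unfolding even pochhammer_rec [of "x + a"] pochhammer_Suc [of "-x + a"] G_def
    by (simp add: algebra_simps)
  have flip: "poly (phi r1 (2 * n + 2)) (-x) = poly (phi r1 (2 * n + 2)) x"
    unfolding even by simp
  have "poly (phi r1 (2 * n + 2)) (-x - 1) =
      pochhammer (-x + a - 1) (Suc n) * pochhammer (x + a + 1) (Suc n)"
    unfolding even by (simp add: algebra_simps)
  also have "\<dots> = (-x + a - 1) * (x + a + 1 + real n) * G"
    unfolding pochhammer_rec [of "-x + a - 1"] pochhammer_Suc [of "x + a + 1"] G_def
    by (simp add: algebra_simps)
  finally have shift: "poly (phi r1 (2 * n + 2)) (-x - 1) - poly (phi r1 (2 * n + 2)) x =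
      (2 * x + 1) * (- (real n + 1) * G)"
    unfolding same by (simp add: algebra_simps)
  have "poly (dunkl_shift r1 r2 \<rho>1 \<rho>2 (phi r1 (2 * n + 2))) x =
      - (real n + 1) * (x - r2 + 1/2) * ((x + a) * G)"
    unfolding poly_dunkl_shift [OF x] flip shift
    using nz by (simp add: a_def)
  then show "poly (dunkl_shift r1 r2 \<rho>1 \<rho>2 (phi r1 (2 * n + 2))) x =
      poly (smult (real n + 1) (phi r1 (2 * n + 2)) +
        smult ((real n + 1) * (r1 + r2 - (real n + 1))) (phi r1 (2 * n + 1))) x"
    unfolding poly_add poly_smult same odd by (simp add: a_def field_simps)
qed simp

text \<open>
  Put \<open>b = a + n\<close>. The first difference is \<open>2x \<phi>\<^bsub>2n\<^esub>\<close>, and \<open>x + a\<close> times the second is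
  \<open>-(2x + 1) \<phi>\<^bsub>2n+1\<^esub> = -(2x + 1)(x + b) \<phi>\<^bsub>2n\<^esub>\<close>, so
  \<open>L \<phi>\<^bsub>2n+1\<^esub>\<close> becomes \<open>((x - \<rho>1)(x - \<rho>2) - (x - r2 + 1/2)(x + b)) \<phi>\<^bsub>2n\<^esub>\<close>. The quadratic terms in the
  bracket cancel; its value at \<open>x = -b\<close> is \<open>\<nu>\<close> and its slope is \<open>\<lambda>\<close>.
\<close>

lemma dunkl_shift_phi_odd:
  "dunkl_shift r1 r2 \<rho>1 \<rho>2 (phi r1 (2 * n + 1)) =
     smult (r1 + r2 - \<rho>1 - \<rho>2 - (real n + 1)) (phi r1 (2 * n + 1)) +
     smult ((\<rho>1 - r1 + real n + 1/2) * (\<rho>2 - r1 + real n + 1/2)) (phi r1 (2 * n))"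
proof (rule poly_eqI_cofinite [of "{0, -1/2}"])
  fix x :: real
  assume "x \<notin> {0, -1/2}"
  then have x: "x \<noteq> 0" "x \<noteq> -1/2" and nz: "2 * x + 1 \<noteq> 0" by auto
  define a where "a = 1/2 - r1"
  define E where "E = pochhammer (x + a) n * pochhammer (-x + a) n"
  define G where "G = pochhammer (x + a + 1) n * pochhammer (-x + a) n"
  have odd: "poly (phi r1 (2 * n + 1)) y = pochhammer (y + a) (Suc n) * pochhammer (-y + a) n" for y
    using poly_phi(2) [of r1 n y] by (simp add: a_def algebra_simps)
  have even: "poly (phi r1 (2 * n)) x = E"
    using poly_phi(1) [of r1 n x] by (simp add: a_def E_def algebra_simps)
  have same: "poly (phi r1 (2 * n + 1)) x = (x + a + real n) * E"
    unfolding odd pochhammer_Suc E_def by (simp add: algebra_simps)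
  have same': "poly (phi r1 (2 * n + 1)) x = (x + a) * G"
    unfolding odd pochhammer_rec G_def by (simp add: algebra_simps)
  have "poly (phi r1 (2 * n + 1)) (-x) = (-x + a + real n) * E"
    unfolding odd pochhammer_Suc E_def by (simp add: algebra_simps)
  then have flip: "poly (phi r1 (2 * n + 1)) x - poly (phi r1 (2 * n + 1)) (-x) = 2 * x * E"
    unfolding same by (simp add: algebra_simps)
  have "poly (phi r1 (2 * n + 1)) (-x - 1) =
      pochhammer (-x + a - 1) (Suc n) * pochhammer (x + a + 1) n"
    unfolding odd by (simp add: algebra_simps)
  also have "\<dots> = (-x + a - 1) * G"
    unfolding pochhammer_rec [of "-x + a - 1"] G_def by (simp add: algebra_simps)
  finally have shift: "poly (phi r1 (2 * n + 1)) (-x - 1) - poly (phi r1 (2 * n + 1)) x =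
      (2 * x + 1) * (- G)"
    unfolding same' by (simp add: algebra_simps)
  have "poly (dunkl_shift r1 r2 \<rho>1 \<rho>2 (phi r1 (2 * n + 1))) x =
      (x - \<rho>1) * (x - \<rho>2) * E - (x - r2 + 1/2) * ((x + a) * G)"
    unfolding poly_dunkl_shift [OF x] flip shift
    using nz x by (simp add: a_def)
  also have "(x + a) * G = (x + a + real n) * E"
    using same same' by simp
  finally show "poly (dunkl_shift r1 r2 \<rho>1 \<rho>2 (phi r1 (2 * n + 1))) x =
      poly (smult (r1 + r2 - \<rho>1 - \<rho>2 - (real n + 1)) (phi r1 (2 * n + 1)) +
        smult ((\<rho>1 - r1 + real n + 1/2) * (\<rho>2 - r1 + real n + 1/2)) (phi r1 (2 * n))) x"
    unfolding poly_add poly_smult same even a_def by (simp add: field_simps)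
qed simp

theorem mainTheorem3:
  fixes r1 r2 \<rho>1 \<rho>2 :: real and n :: nat
  shows "(\<lambda>x. poly (phi r1 n) x - (-1) ^ (n * (n - 1) div 2) * x ^ n)
           \<in> O[at_infinity](\<lambda>x. x powi (int n - 1)) \<and>
         dunkl_shift r1 r2 \<rho>1 \<rho>2 (phi r1 n) =
           smult (eigval r1 r2 \<rho>1 \<rho>2 n) (phi r1 n) +
           smult (lowcoeff r1 r2 \<rho>1 \<rho>2 n) (if n = 0 then 0 else phi r1 (n - 1))"
proof
  show "(\<lambda>x. poly (phi r1 n) x - (-1) ^ (n * (n - 1) div 2) * x ^ n)
           \<in> O[at_infinity](\<lambda>x. x powi (int n - 1))"
    using poly_minus_leading_term_bigo [of "phi r1 n"] phi_leading(2) [of r1 n]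
    unfolding phi_leading(1) by simp
  consider "n = 0" | k where "n = 2 * k + 2" | k where "n = 2 * k + 1"
    by (cases n) (auto, metis add_2_eq_Suc' even_Suc evenE oddE mult_Suc_right Suc_eq_plus1)
  then show "dunkl_shift r1 r2 \<rho>1 \<rho>2 (phi r1 n) =
           smult (eigval r1 r2 \<rho>1 \<rho>2 n) (phi r1 n) +
           smult (lowcoeff r1 r2 \<rho>1 \<rho>2 n) (if n = 0 then 0 else phi r1 (n - 1))"
  proof cases
    case 1
    then show ?thesis
      by (simp add: phi_def dunkl_shift_def eigval_def lowcoeff_def pcompose_1)
  next
    case (2 k)
    have "eigval r1 r2 \<rho>1 \<rho>2 n = real k + 1"
      "lowcoeff r1 r2 \<rho>1 \<rho>2 n = (real k + 1) * (r1 + r2 - (real k + 1))"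
      by (simp_all add: 2 eigval_def lowcoeff_def add_divide_distrib add.commute)
    with 2 dunkl_shift_phi_even [of r1 r2 \<rho>1 \<rho>2 k] show ?thesis by simp
  next
    case (3 k)
    have "eigval r1 r2 \<rho>1 \<rho>2 n = r1 + r2 - \<rho>1 - \<rho>2 - (real k + 1)"
      "lowcoeff r1 r2 \<rho>1 \<rho>2 n = (\<rho>1 - r1 + real k + 1/2) * (\<rho>2 - r1 + real k + 1/2)"
      by (simp_all add: 3 eigval_def lowcoeff_def add_divide_distrib algebra_simps)
    with 3 dunkl_shift_phi_odd [of r1 r2 \<rho>1 \<rho>2 k] show ?thesis by simp
  qed
qed

end
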